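(* Let $(K, D, \star)$ be a complete probabilistic metric space such that the triangle function $\star$ is continuous and sup-continuous. Then the following assertions are equivalent: (1) $(K, D, \star)$ is compact; (2) the metric space $(Lip^1_\star(K,\Delta^+), d_\infty)$ is compact (equivalently, $Lip^1_\star(K,\Delta^+)$ is a compact subset of $(C_\star(K,\Delta^+), d_\infty)$).
   Context: **Distribution functions.** $\Delta^+$ is the set of all functions $F:[-\infty,+\infty]\to[0,1]$ that are nondecreasing, left-continuous at every real point, and satisfy $F(-\infty)=0$, $F(+\infty)=1$, $F(0)=0$. The order $F\le L$ on $\Delta^+$ means $F(t)\le L(t)$ for all $t\in\mathbb{R}$. $\mathcal{H}_0\in\Delta^+$ is given by $\mathcal{H}_0(t)=0$ for $t\le 0$ and $\mathcal{H}_0(t)=1$ for $t>0$; it is the maximal element of $\Delta^+$. Pointwise suprema of nonempty families in $\Delta^+$ belong to $\Delta^+$. **Weak convergence.** A sequence $(F_n)$ in $\Delta^+$ converges weakly to $F\in\Delta^+$, written $F_n\xrightarrow{w}F$, if $F_n(t)\to F(t)$ at each continuity point $t$ of $F$. **Triangle functions.** A triangle function is a binary operation $\star:\Delta^+\times\Delta^+\to\Delta^+$ that is commutative, associative, nondecreasing in each argument (for $\le$), and has $\mathcal{H}_0$ as neutral element. It is continuous if $F_n\xrightarrow{w}F$ and $L_n\xrightarrow{w}L$ imply $F_n\star L_n\xrightarrow{w}F\star L$. It is sup-continuous if for every nonempty family $(F_i)_{i\in I}$ in $\Delta^+$ and every $L\in\Delta^+$, $\sup_{i\in I}(F_i\star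 L)=(\sup_{i\in I}F_i)\star L$. **Probabilistic metric spaces.** $(K,D,\star)$ is a probabilistic metric space if $K$ is a set, $\star$ is a triangle function and $D:K\times K\to\Delta^+$ satisfies: $D(p,q)=\mathcal{H}_0$ iff $p=q$; $D(p,q)=D(q,p)$; and $D(p,q)\star D(q,r)\le D(p,r)$ for all $p,q,r\in K$. A sequence $(z_n)$ in $K$ is Cauchy if $\lim_{n,p\to\infty}D(z_n,z_p)(t)=\mathcal{H}_0(t)$ for all $t\in\mathbb{R}$. It converges to $z\in K$ if $\lim_{n}D(z_n,z)(t)=\mathcal{H}_0(t)$ for all $t\in\mathbb{R}$. The space is complete if every Cauchy sequence converges to some point of $K$. For $x\in K$ and $t>0$, let $N_x(t)=\{y\in K: D(x,y)(t)>1-t\}$. A complete probabilistic metric space $(K,D,\star)$ is compact if for every $t>0$ the cover $\{N_x(t):x\in K\}$ of $K$ has a finite subcover. **Modified Lévy distance.** For $F,L\in\Delta^+$ and $h\in(0,1]$, let $A(F,L;h)$ be the condition: $0\le L(t)\le F(t+h)+h$ for all $t\in(0,h^{-1})$. Set $d_L(F,L)=\inf\{h\in(0,1]: A(F,L;h)\text{ and }A(L,F;h)\text{ hold}\}$. It is known that $d_L$ is a metric on $\Delta^+$. **Function spaces.** A map $f:K\to\Delta^+$ is continuous if, for every $z\in K$ and every sequence $(z_n)$ in $K$ with $D(z_n,z)\xrightarrow{w}\mathcal{H}_0$, one has $f(z_n)\xrightarrow{w}f(z)$. $C_\star(K,\Delta^+)$ is the set of all continuous maps $f:K\to\Delta^+$.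 A map $f:K\to\Delta^+$ is probabilistic $1$-Lipschitz if $D(x,y)\star f(y)\le f(x)$ for all $x,y\in K$; $Lip^1_\star(K,\Delta^+)$ is the set of all such maps (it is known that it is contained in $C_\star(K,\Delta^+)$ when $\star$ is continuous). The metric is $d_\infty(f,g)=\sup_{x\in K}d_L(f(x),g(x))$. *)

theory Defs
  imports "HOL-Analysis.Analysis"
begin

section \<open>Distribution functions\<close>

typedef df = "{F :: ereal \<Rightarrow> real.
    (\<forall>t. 0 \<le> F t \<and> F t \<le> 1) \<and> mono F \<and>
    (\<forall>x::real. (F \<longlongrightarrow> F (ereal x)) (at_left (ereal x))) \<and>
    F (-\<infinity>) = 0 \<and> F \<infinity> = 1 \<and> F 0 = 0}"
  morphisms app_df Abs_df
proof
  let ?F = "\<lambda>t::ereal. if t = \<infinity> then 1 else 0 :: real"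
  have "(?F \<longlongrightarrow> ?F (ereal x)) (at_left (ereal x))" for x :: real
  proof (rule tendsto_eventually)
    show "eventually (\<lambda>y. ?F y = ?F (ereal x)) (at_left (ereal x))"
      unfolding eventually_at_filter by (auto intro!: always_eventually)
  qed
  then show "?F \<in> {F. (\<forall>t. 0 \<le> F t \<and> F t \<le> 1) \<and> mono F \<and>
      (\<forall>x::real. (F \<longlongrightarrow> F (ereal x)) (at_left (ereal x))) \<and>
      F (-\<infinity>) = 0 \<and> F \<infinity> = 1 \<and> F 0 = 0}"
    by (auto simp: mono_def)
qed

setup_lifting type_definition_df

lemma app_df_ge_0: "0 \<le> app_df F t"
  and app_df_le_1: "app_df F t \<le> 1"
  and app_df_mono: "s \<le> t \<Longrightarrow> app_df F s \<le> app_df F t"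
  and app_df_left_cont: "(app_df F \<longlongrightarrow> app_df F (ereal x)) (at_left (ereal x))"
  and app_df_MInf: "app_df F (-\<infinity>) = 0"
  and app_df_PInf: "app_df F \<infinity> = 1"
  and app_df_0: "app_df F 0 = 0"
  using app_df[of F] by (auto simp: mono_def)

lemma df_eqI:
  assumes "\<And>t::real. app_df F (ereal t) = app_df L (ereal t)"
  shows "F = L"
proof -
  have "app_df F t = app_df L t" for t
    by (cases t) (simp_all add: assms app_df_MInf app_df_PInf)
  then show ?thesis
    by (metis app_df_inject ext)
qed

instantiation df :: order
begin

definition less_eq_df :: "df \<Rightarrow> df \<Rightarrow> bool" where
  "F \<le> L \<longleftrightarrow> (\<forall>t::real. app_df F (ereal t) \<le> app_df L (ereal t))"

definition less_df :: "df \<Rightarrow> df \<Rightarrow> bool" where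
  "F < L \<longleftrightarrow> F \<le> L \<and> \<not> L \<le> F" for F L :: df

instance
proof
  fix F G L :: df
  show "F < L \<longleftrightarrow> F \<le> L \<and> \<not> L \<le> F" by (rule less_df_def)
  show "F \<le> F" by (simp add: less_eq_df_def)
  show "F \<le> G \<Longrightarrow> G \<le> L \<Longrightarrow> F \<le> L"
    unfolding less_eq_df_def by (meson order_trans)
  show "F \<le> L \<Longrightarrow> L \<le> F \<Longrightarrow> F = L"
    unfolding less_eq_df_def by (intro df_eqI) (simp add: antisym)
qed

end

lift_definition H0 :: df is "\<lambda>t. if t \<le> 0 then 0 else 1"
proof -
  let ?H = "\<lambda>t::ereal. if t \<le> 0 then 0 else 1 :: real"
  have "(?H \<longlongrightarrow> ?H (ereal x)) (at_left (ereal x))" for x :: real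
  proof (rule tendsto_eventually, cases "x \<le> 0")
    case True
    then have "y \<le> 0" if "y < ereal x" for y
      using that by (cases y) auto
    with True show "eventually (\<lambda>y. ?H y = ?H (ereal x)) (at_left (ereal x))"
      unfolding eventually_at_filter by (intro always_eventually) auto
  next
    case False
    then have "eventually (\<lambda>y. y \<in> {0<..<ereal x}) (at_left (ereal x))"
      by (intro eventually_at_leftI[where a = 0]) auto
    then show "eventually (\<lambda>y. ?H y = ?H (ereal x)) (at_left (ereal x))"
      by eventually_elim (use False in auto)
  qed
  then show "(\<forall>t. 0 \<le> ?H t \<and> ?H t \<le> 1) \<and> mono ?H \<and>
      (\<forall>x::real. (?H \<longlongrightarrow> ?H (ereal x)) (at_left (ereal x))) \<and>
      ?H (-\<infinity>) = 0 \<and> ?H \<infinity> = 1 \<and> ?H 0 = 0"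
    by (auto simp: mono_def)
qed

lemma bdd_above_app_df: "bdd_above ((\<lambda>F. app_df F t) ` S)"
  by (rule bdd_aboveI2[where M = 1]) (rule app_df_le_1)

instantiation df :: Sup
begin

(* The supremum of a nonempty set is pointwise.  The supremum of the empty set is irrelevant
   below; it is the least distribution function. *)
lift_definition Sup_df :: "df set \<Rightarrow> df" is
  "\<lambda>S t. if S = {} then (if t = \<infinity> then 1 else 0) else (SUP F\<in>S. app_df F t)"
proof -
  fix S :: "df set"
  let ?G = "\<lambda>t. if S = {} then (if t = \<infinity> then 1 else 0) else (SUP F\<in>S. app_df F t)"
  show "(\<forall>t. 0 \<le> ?G t \<and> ?G t \<le> 1) \<and> mono ?G \<and>
      (\<forall>x::real. (?G \<longlongrightarrow> ?G (ereal x)) (at_left (ereal x))) \<and>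
      ?G (-\<infinity>) = 0 \<and> ?G \<infinity> = 1 \<and> ?G 0 = 0"
  proof (cases "S = {}")
    case True
    have "((\<lambda>t. if t = \<infinity> then 1 else 0 :: real) \<longlongrightarrow> 0) (at_left (ereal x))" for x :: real
    proof (rule tendsto_eventually)
      show "eventually (\<lambda>y. (if y = \<infinity> then 1 else 0) = (0::real)) (at_left (ereal x))"
        unfolding eventually_at_filter by (auto intro!: always_eventually)
    qed
    with True show ?thesis by (auto simp: mono_def)
  next
    case False
    then obtain F0 where F0: "F0 \<in> S" by blast
    let ?g = "\<lambda>t. SUP F\<in>S. app_df F t"
    have up: "app_df F t \<le> ?g t" if "F \<in> S" for F t
      using that by (rule cSUP_upper) (rule bdd_above_app_df)
    have mono: "?g s \<le> ?g t" if "s \<le> t" for s t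
      using False that
      by (intro cSUP_least) (auto intro: order_trans[OF app_df_mono up])
    have lc: "(?g \<longlongrightarrow> ?g (ereal x)) (at_left (ereal x))" for x :: real
    proof (rule order_tendstoI)
      fix a assume "a < ?g (ereal x)"
      then obtain F where F: "F \<in> S" "a < app_df F (ereal x)"
        using False by (auto simp: less_cSUP_iff bdd_above_app_df)
      have "eventually (\<lambda>y. a < app_df F y) (at_left (ereal x))"
        using order_tendstoD(1)[OF app_df_left_cont F(2)] .
      then show "eventually (\<lambda>y. a < ?g y) (at_left (ereal x))"
        by eventually_elim (use up[OF F(1)] less_le_trans in blast)
    next
      fix a assume a: "?g (ereal x) < a"
      show "eventually (\<lambda>y. ?g y < a) (at_left (ereal x))"
        unfolding eventually_at_filter
      proof (intro always_eventually allI impI)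
        fix y assume "y \<in> {..<ereal x}"
        then have "?g y \<le> ?g (ereal x)" by (intro mono) simp
        with a show "?g y < a" by simp
      qed
    qed
    have "0 \<le> ?g t" for t
      using up[OF F0, of t] app_df_ge_0[of F0 t] by simp
    moreover have "?g t \<le> 1" for t
      using False by (intro cSUP_least) (auto simp: app_df_le_1)
    moreover have "?g (-\<infinity>) = 0" "?g \<infinity> = 1" "?g 0 = 0"
      using False by (simp_all add: app_df_MInf app_df_PInf app_df_0)
    ultimately show ?thesis
      using False lc mono by (auto simp: mono_def)
  qed
qed

instance ..

end

definition weak_conv :: "(nat \<Rightarrow> df) \<Rightarrow> df \<Rightarrow> bool" where
  "weak_conv F L \<longleftrightarrow>
     (\<forall>t. isCont (app_df L) t \<longrightarrow> (\<lambda>n. app_df (F n) t) \<longlonglongrightarrow> app_df L t)"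


section \<open>Triangle functions\<close>

locale triangle_function = comm_monoid star H0
  for star :: "df \<Rightarrow> df \<Rightarrow> df"  (infixl \<open>\<star>\<close> 70) +
  assumes mono_left: "F \<le> F' \<Longrightarrow> F \<star> L \<le> F' \<star> L"
    and mono_right: "L \<le> L' \<Longrightarrow> F \<star> L \<le> F \<star> L'"

definition continuous_tf :: "(df \<Rightarrow> df \<Rightarrow> df) \<Rightarrow> bool" where
  "continuous_tf star \<longleftrightarrow>
     (\<forall>Fs F Ls L. weak_conv Fs F \<and> weak_conv Ls L
        \<longrightarrow> weak_conv (\<lambda>n. star (Fs n) (Ls n)) (star F L))"

(* Suprema depend only on the range of a family, so nonempty families are given by nonempty sets. *)
definition sup_continuous_tf :: "(df \<Rightarrow> df \<Rightarrow> df) \<Rightarrow> bool" where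
  "sup_continuous_tf star \<longleftrightarrow>
     (\<forall>S L. S \<noteq> {} \<longrightarrow> (SUP F\<in>S. star F L) = star (Sup S) L)"


section \<open>Probabilistic metric spaces\<close>

locale prob_metric_space = triangle_function star
  for K :: "'a set" and D :: "'a \<Rightarrow> 'a \<Rightarrow> df"
    and star :: "df \<Rightarrow> df \<Rightarrow> df"  (infixl \<open>\<star>\<close> 70) +
  assumes D_eq_H0_iff: "p \<in> K \<Longrightarrow> q \<in> K \<Longrightarrow> D p q = H0 \<longleftrightarrow> p = q"
    and D_commute: "p \<in> K \<Longrightarrow> q \<in> K \<Longrightarrow> D p q = D q p"
    and D_triangle: "p \<in> K \<Longrightarrow> q \<in> K \<Longrightarrow> r \<in> K \<Longrightarrow> D p q \<star> D q r \<le> D p r"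

definition pm_Cauchy :: "'a set \<Rightarrow> ('a \<Rightarrow> 'a \<Rightarrow> df) \<Rightarrow> (nat \<Rightarrow> 'a) \<Rightarrow> bool" where
  "pm_Cauchy K D z \<longleftrightarrow> range z \<subseteq> K \<and>
     (\<forall>t::real. ((\<lambda>(n, p). app_df (D (z n) (z p)) (ereal t)) \<longlongrightarrow> app_df H0 (ereal t))
        (sequentially \<times>\<^sub>F sequentially))"

definition pm_converges :: "'a set \<Rightarrow> ('a \<Rightarrow> 'a \<Rightarrow> df) \<Rightarrow> (nat \<Rightarrow> 'a) \<Rightarrow> 'a \<Rightarrow> bool" where
  "pm_converges K D z l \<longleftrightarrow> range z \<subseteq> K \<and> l \<in> K \<and>
     (\<forall>t::real. (\<lambda>n. app_df (D (z n) l) (ereal t)) \<longlonglongrightarrow> app_df H0 (ereal t))"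

definition pm_complete :: "'a set \<Rightarrow> ('a \<Rightarrow> 'a \<Rightarrow> df) \<Rightarrow> bool" where
  "pm_complete K D \<longleftrightarrow> (\<forall>z. pm_Cauchy K D z \<longrightarrow> (\<exists>l. pm_converges K D z l))"

definition pm_nbhd :: "'a set \<Rightarrow> ('a \<Rightarrow> 'a \<Rightarrow> df) \<Rightarrow> 'a \<Rightarrow> real \<Rightarrow> 'a set" where
  "pm_nbhd K D x t = {y \<in> K. app_df (D x y) (ereal t) > 1 - t}"

definition pm_compact :: "'a set \<Rightarrow> ('a \<Rightarrow> 'a \<Rightarrow> df) \<Rightarrow> bool" where
  "pm_compact K D \<longleftrightarrow> pm_complete K D \<and>
     (\<forall>t>0. \<exists>X. finite X \<and> X \<subseteq> K \<and> K \<subseteq> (\<Union>x\<in>X. pm_nbhd K D x t))"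


section \<open>The modified Levy distance\<close>

definition levy_cond :: "df \<Rightarrow> df \<Rightarrow> real \<Rightarrow> bool" where
  "levy_cond F L h \<longleftrightarrow>
     (\<forall>t\<in>{0<..<inverse h}. 0 \<le> app_df L (ereal t) \<and>
        app_df L (ereal t) \<le> app_df F (ereal (t + h)) + h)"

definition levy_dist :: "df \<Rightarrow> df \<Rightarrow> real" where
  "levy_dist F L = Inf {h \<in> {0<..1}. levy_cond F L h \<and> levy_cond L F h}"

lemma levy_cond_mono:
  assumes "levy_cond F L h" "0 < h" "h \<le> k"
  shows "levy_cond F L k"
  unfolding levy_cond_def
proof
  fix t assume t: "t \<in> {0<..<inverse k}"
  then have "t \<in> {0<..<inverse h}"
    using le_imp_inverse_le[OF assms(3,2)] by simp
  then have "app_df L (ereal t) \<le> app_df F (ereal (t + h)) + h"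
    using assms(1) by (auto simp: levy_cond_def)
  also have "\<dots> \<le> app_df F (ereal (t + k)) + k"
    using assms(3) by (intro add_mono app_df_mono) auto
  finally show "0 \<le> app_df L (ereal t) \<and> app_df L (ereal t) \<le> app_df F (ereal (t + k)) + k"
    by (simp add: app_df_ge_0)
qed

lemma levy_cond_1: "levy_cond F L 1"
  unfolding levy_cond_def
  by (auto simp: app_df_ge_0 intro: order_trans[OF app_df_le_1] add_increasing)

lemma levy_dist_bounds: "0 \<le> levy_dist F L" "levy_dist F L \<le> 1"
proof -
  show "0 \<le> levy_dist F L"
    unfolding levy_dist_def
    by (rule cInf_greatest) (auto intro!: exI[of _ 1] levy_cond_1)
  show "levy_dist F L \<le> 1"
    unfolding levy_dist_def
    by (rule cInf_lower) (auto intro!: bdd_belowI[of _ 0] levy_cond_1)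
qed

lemma levy_dist_less:
  assumes "levy_dist F L < h"
  shows "levy_cond F L h \<and> levy_cond L F h"
proof -
  let ?A = "{h \<in> {0<..1}. levy_cond F L h \<and> levy_cond L F h}"
  have "?A \<noteq> {}" "bdd_below ?A"
    by (auto intro!: exI[of _ 1] levy_cond_1 bdd_belowI[of _ 0])
  then obtain k where "k \<in> ?A" "k < h"
    using assms unfolding levy_dist_def by (meson cInf_less_iff)
  then show ?thesis
    by (auto intro: levy_cond_mono)
qed

lemma levy_dist_le:
  assumes "0 < h" "levy_cond F L h" "levy_cond L F h"
  shows "levy_dist F L \<le> h"
proof (cases "h \<le> 1")
  case True
  then show ?thesis
    unfolding levy_dist_def using assms
    by (intro cInf_lower) (auto intro!: bdd_belowI[of _ 0])
qed (use levy_dist_bounds(2)[of F L] in simp)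

lemma levy_cond_trans:
  assumes "levy_cond F G h" "levy_cond G L k" "0 < h" "0 < k" "h + k \<le> 1"
  shows "levy_cond F L (h + k)"
  unfolding levy_cond_def
proof
  fix t assume t: "t \<in> {0<..<inverse (h + k)}"
  have "inverse (h + k) \<le> inverse k"
    using assms by (intro le_imp_inverse_le) auto
  then have "t \<in> {0<..<inverse k}" using t by auto
  then have 1: "app_df L (ereal t) \<le> app_df G (ereal (t + k)) + k"
    using assms(2) by (auto simp: levy_cond_def)
  have "h * (h + k) \<le> 1 * 1"
    using assms by (intro mult_mono) auto
  then have "k * (h * (h + k)) \<le> k * 1"
    using assms by (intro mult_left_mono) auto
  then have "inverse (h + k) + k \<le> inverse h"
    using assms by (simp add: field_simps)
  then have "t + k \<in> {0<..<inverse h}" using t assms by auto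
  then have "app_df G (ereal (t + k)) \<le> app_df F (ereal (t + k + h)) + h"
    using assms(1) by (auto simp: levy_cond_def)
  with 1 show "0 \<le> app_df L (ereal t) \<and>
      app_df L (ereal t) \<le> app_df F (ereal (t + (h + k))) + (h + k)"
    by (simp add: app_df_ge_0 algebra_simps)
qed

lemma levy_dist_commute: "levy_dist F L = levy_dist L F"
  unfolding levy_dist_def by (simp add: conj_commute)

lemma levy_dist_triangle: "levy_dist F L \<le> levy_dist F G + levy_dist G L"
proof (cases "levy_dist F G + levy_dist G L < 1")
  case True
  show ?thesis
  proof (rule field_le_epsilon)
    fix e :: real assume "0 < e"
    define e' where "e' = min e (1 - (levy_dist F G + levy_dist G L))"
    have e': "0 < e'" "e' \<le> e" "levy_dist F G + levy_dist G L + e' \<le> 1"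
      using True \<open>0 < e\<close> by (auto simp: e'_def)
    let ?h = "levy_dist F G + e'/2" and ?k = "levy_dist G L + e'/2"
    have pos: "0 < ?h" "0 < ?k" "?h + ?k \<le> 1" "?k + ?h \<le> 1"
      using e' levy_dist_bounds[of F G] levy_dist_bounds[of G L] by auto
    have h: "levy_cond F G ?h" "levy_cond G F ?h"
      using levy_dist_less[of F G ?h] e' by auto
    have k: "levy_cond G L ?k" "levy_cond L G ?k"
      using levy_dist_less[of G L ?k] e' by auto
    have "levy_cond F L (?h + ?k)" by (rule levy_cond_trans[OF h(1) k(1) pos(1,2,3)])
    moreover have "levy_cond L F (?h + ?k)"
      using levy_cond_trans[OF k(2) h(2) pos(2,1,4)] by (simp add: add.commute)
    ultimately have "levy_dist F L \<le> ?h + ?k"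
      using pos by (intro levy_dist_le) auto
    then show "levy_dist F L \<le> levy_dist F G + levy_dist G L + e"
      using e' by simp
  qed
qed (use levy_dist_bounds(2)[of F L] in simp)

lemma levy_dist_self: "levy_dist F F = 0"
proof -
  have "levy_dist F F \<le> 0 + e" if "0 < e" for e
  proof -
    have "levy_cond F F e"
      unfolding levy_cond_def using that
      by (auto simp: app_df_ge_0 intro!: add_increasing2 app_df_mono)
    then show ?thesis using that by (simp add: levy_dist_le)
  qed
  then have "levy_dist F F \<le> 0" by (rule field_le_epsilon)
  with levy_dist_bounds(1)[of F F] show ?thesis by simp
qed

lemma levy_dist_zero_imp_le:
  assumes "levy_dist F L = 0"
  shows "L \<le> F"
  unfolding less_eq_df_def
proof
  fix t :: real
  show "app_df L (ereal t) \<le> app_df F (ereal t)"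
  proof (cases "t \<le> 0")
    case True
    then have "app_df L (ereal t) \<le> app_df L 0" by (intro app_df_mono) auto
    then show ?thesis using app_df_0[of L] app_df_ge_0[of F "ereal t"] by simp
  next
    case False
    define s where "s n = t - inverse (real (Suc n))" for n
    have "(\<lambda>n. t - inverse (real (Suc n))) \<longlonglongrightarrow> t - 0"
      by (intro tendsto_intros LIMSEQ_inverse_real_of_nat)
    then have s: "s \<longlonglongrightarrow> t" unfolding s_def by simp
    then have "(\<lambda>n. ereal (s n)) \<longlonglongrightarrow> ereal t" by simp
    moreover have "eventually (\<lambda>n. ereal (s n) \<in> {..<ereal t} \<and> ereal (s n) \<noteq> ereal t) sequentially"
      by (intro always_eventually) (simp add: s_def)
    ultimately have "filterlim (\<lambda>n. ereal (s n)) (at_left (ereal t)) sequentially"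
      by (simp add: filterlim_at)
    then have lim1: "(\<lambda>n. app_df L (ereal (s n))) \<longlonglongrightarrow> app_df L (ereal t)"
      by (rule filterlim_compose[OF app_df_left_cont])
    have "(\<lambda>n. app_df F (ereal t) + inverse (real (Suc n))) \<longlonglongrightarrow> app_df F (ereal t) + 0"
      by (intro tendsto_intros LIMSEQ_inverse_real_of_nat)
    then have lim2: "(\<lambda>n. app_df F (ereal t) + inverse (real (Suc n))) \<longlonglongrightarrow> app_df F (ereal t)"
      by simp
    have "eventually (\<lambda>n. 0 < s n) sequentially"
      using order_tendstoD(1)[OF s, of 0] False by simp
    moreover have "eventually (\<lambda>n. t < real n) sequentially"
      using filterlim_real_sequentially by (auto simp: filterlim_at_top_dense)
    ultimately have "eventually (\<lambda>n. app_df L (ereal (s n)) \<le>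
        app_df F (ereal t) + inverse (real (Suc n))) sequentially"
    proof eventually_elim
      case (elim n)
      have "levy_cond F L (inverse (real (Suc n)))"
        using levy_dist_less[of F L "inverse (real (Suc n))"] assms by simp
      moreover have "s n < real (Suc n)"
      proof -
        have "0 < inverse (real (Suc n))" by simp
        then have "s n < t" unfolding s_def by linarith
        with elim show ?thesis by simp
      qed
      ultimately have "app_df L (ereal (s n)) \<le>
          app_df F (ereal (s n + inverse (real (Suc n)))) + inverse (real (Suc n))"
        using elim by (simp add: levy_cond_def)
      moreover have "s n + inverse (real (Suc n)) = t" by (simp add: s_def)
      ultimately show ?case by simp
    qed
    then show ?thesis
      by (rule tendsto_le[OF sequentially_bot lim2 lim1])
  qed
qed

lemma levy_dist_zero_iff: "levy_dist F L = 0 \<longleftrightarrow> F = L"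
  by (metis antisym levy_dist_commute levy_dist_self levy_dist_zero_imp_le)

lemma Metric_space_levy_dist: "Metric_space UNIV levy_dist"
  by unfold_locales
     (auto simp: levy_dist_bounds levy_dist_commute levy_dist_zero_iff levy_dist_triangle)


section \<open>Function spaces\<close>

(* Functions on K are represented by their extensions by undefined outside K. *)
definition cont_df :: "'a set \<Rightarrow> ('a \<Rightarrow> 'a \<Rightarrow> df) \<Rightarrow> ('a \<Rightarrow> df) set" where
  "cont_df K D = {f \<in> extensional K.
     \<forall>z\<in>K. \<forall>zs. range zs \<subseteq> K \<and> weak_conv (\<lambda>n. D (zs n) z) H0
       \<longrightarrow> weak_conv (\<lambda>n. f (zs n)) (f z)}"

definition Lip1_df ::
    "'a set \<Rightarrow> ('a \<Rightarrow> 'a \<Rightarrow> df) \<Rightarrow> (df \<Rightarrow> df \<Rightarrow> df) \<Rightarrow> ('a \<Rightarrow> df) set" where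
  "Lip1_df K D star = {f \<in> extensional K. \<forall>x\<in>K. \<forall>y\<in>K. star (D x y) (f y) \<le> f x}"

(* The supremum is taken in [0,1], hence is 0 when K is empty; Sup {} is unspecified in real. *)
definition sup_dist :: "'a set \<Rightarrow> ('a \<Rightarrow> df) \<Rightarrow> ('a \<Rightarrow> df) \<Rightarrow> real" where
  "sup_dist K f g = (if K = {} then 0 else SUP x\<in>K. levy_dist (f x) (g x))"

lemma Metric_space_sup_dist:
  assumes "M \<subseteq> extensional K"
  shows "Metric_space M (sup_dist K)"
proof
  have up: "levy_dist (f x) (g x) \<le> sup_dist K f g" if "x \<in> K" for f g x
    using that unfolding sup_dist_def
    by (auto intro!: cSUP_upper bdd_aboveI2[where M = 1] levy_dist_bounds)
  have least: "sup_dist K f g \<le> c" if "0 \<le> c" "\<And>x. x \<in> K \<Longrightarrow> levy_dist (f x) (g x) \<le> c" for f g c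
    using that unfolding sup_dist_def by (auto intro!: cSUP_least)
  fix f g h
  show nonneg: "0 \<le> sup_dist K f g" for f g
  proof (cases "K = {}")
    case False
    then obtain x where "x \<in> K" by blast
    then show ?thesis
      using up[of x f g] levy_dist_bounds(1)[of "f x" "g x"] by simp
  qed (simp add: sup_dist_def)
  show "sup_dist K f g = sup_dist K g f"
    by (simp add: sup_dist_def levy_dist_commute)
  show "sup_dist K f g = 0 \<longleftrightarrow> f = g" if "f \<in> M" "g \<in> M"
  proof
    assume 0: "sup_dist K f g = 0"
    have "f x = g x" if "x \<in> K" for x
      using up[OF that, of f g] 0 levy_dist_bounds(1)[of "f x" "g x"]
      by (simp add: levy_dist_zero_iff)
    then show "f = g"
      using that assms by (intro extensionalityI[of f K g]) auto
  next
    assume "f = g"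
    then show "sup_dist K f g = 0"
      by (simp add: sup_dist_def levy_dist_self)
  qed
  show "sup_dist K f h \<le> sup_dist K f g + sup_dist K g h"
  proof (rule least)
    fix x assume "x \<in> K"
    then show "levy_dist (f x) (h x) \<le> sup_dist K f g + sup_dist K g h"
      using levy_dist_triangle[of "f x" "h x" "g x"] up[of x f g] up[of x g h] by simp
  qed (use nonneg[of f g] nonneg[of g h] in simp)
qed

end

theory Submission
  imports "HOL-Probability.Helly_Selection" Defs
begin

text \<open>
  By Helly's selection theorem, distribution functions form a compact metric space under the
  modified Levy distance, which metrizes weak convergence. Compactness and continuity of the
  triangle function make the 1-Lipschitz maps uniformly equicontinuous, so an Arzela-Ascoli
  argument gives total boundedness of the Lipschitz space over a totally bounded \<open>K\<close>; it is always
  complete. Conversely, \<open>x \<mapsto> D _ x\<close> maps \<open>K\<close> into the Lipschitz space, and evaluating the images of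
  \<open>x\<close> and \<open>y\<close> at \<open>y\<close> shows that they are at distance at least \<open>levy_dist H0 (D x y)\<close>, so a finite
  net of the images is a finite net of \<open>K\<close>.
\<close>

section \<open>Distribution functions on the real line\<close>

lemma app_df_nonpos: "x \<le> 0 \<Longrightarrow> app_df F (ereal x) = 0"
  using app_df_mono[of "ereal x" 0 F] app_df_ge_0[of F "ereal x"] app_df_0[of F] by simp

lemma app_df_left_cont_real:
  "((\<lambda>s. app_df F (ereal s)) \<longlongrightarrow> app_df F (ereal x)) (at_left x)"
  using app_df_left_cont[of F x] by (simp add: at_left_ereal filterlim_filtermap)

lemma isCont_app_df_ereal: "isCont (app_df F) (ereal x) \<longleftrightarrow> isCont (\<lambda>x. app_df F (ereal x)) x"
  unfolding isCont_def by (simp only: at_ereal filterlim_filtermap)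

text \<open>At both infinite arguments all distribution functions agree, so these points impose no
  condition. This allows working with monotone functions on the reals.\<close>

lemma weak_conv_iff_real:
  "weak_conv Fs F \<longleftrightarrow>
     (\<forall>x. isCont (\<lambda>x. app_df F (ereal x)) x \<longrightarrow>
        (\<lambda>n. app_df (Fs n) (ereal x)) \<longlonglongrightarrow> app_df F (ereal x))"
  unfolding weak_conv_def
proof (intro iffI allI impI)
  fix t assume *: "\<forall>x. isCont (\<lambda>x. app_df F (ereal x)) x \<longrightarrow>
        (\<lambda>n. app_df (Fs n) (ereal x)) \<longlonglongrightarrow> app_df F (ereal x)" and t: "isCont (app_df F) t"
  show "(\<lambda>n. app_df (Fs n) t) \<longlonglongrightarrow> app_df F t"
    using * t by (cases t) (simp_all add: isCont_app_df_ereal app_df_PInf app_df_MInf)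
qed (simp add: isCont_app_df_ereal)

lemma mono_app_df_ereal: "mono (\<lambda>x. app_df F (ereal x))"
  by (auto simp: mono_def intro: app_df_mono)

text \<open>The discontinuities of a monotone function are countable, so they cannot fill an
  interval. This supplies continuity points on either side of any given point.\<close>

lemma mono_cont_point:
  fixes G :: "real \<Rightarrow> real"
  assumes "mono G" "a < b"
  shows "\<exists>x. a < x \<and> x < b \<and> isCont G x"
proof (rule ccontr)
  assume "\<not> ?thesis"
  then have "{a<..<b} \<subseteq> {x. \<not> isCont G x}" by auto
  with assms show False
    using countable_subset[OF _ mono_ctble_discont] uncountable_open_interval by blast
qed

text \<open>A failure at \<open>t\<close> persists on an interval to the left of \<open>t\<close>,
  by left-continuity of \<open>F\<close> and monotonicity of \<open>L\<close>, and no interval fits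
  into a countable set.\<close>

lemma df_le_cocountable:
  assumes C: "countable C" and le: "\<And>x. x \<notin> C \<Longrightarrow> app_df F (ereal x) \<le> app_df L (ereal x)"
  shows "F \<le> L"
  unfolding less_eq_df_def
proof (rule ccontr, clarsimp simp: not_le)
  fix t assume "app_df L (ereal t) < app_df F (ereal t)"
  from order_tendstoD(1)[OF app_df_left_cont_real this]
  obtain a where a: "a < t" "\<And>s. a < s \<Longrightarrow> s < t \<Longrightarrow> app_df L (ereal t) < app_df F (ereal s)"
    by (auto simp: eventually_at_left_field)
  have "{a<..<t} \<subseteq> C"
  proof
    fix s assume s: "s \<in> {a<..<t}"
    then have "app_df L (ereal s) \<le> app_df L (ereal t)"
      by (intro app_df_mono) simp
    with a(2)[of s] le[of s] s show "s \<in> C" by force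
  qed
  with C a(1) show False
    using countable_subset uncountable_open_interval by blast
qed

text \<open>Inequalities pass to the limit at common continuity points, and only countably many
  points are not of this kind.\<close>

lemma weak_conv_le:
  assumes "weak_conv Fs F" "weak_conv Ls L" "\<And>n. Fs n \<le> Ls n"
  shows "F \<le> L"
proof (rule df_le_cocountable)
  show "countable ({x. \<not> isCont (\<lambda>x. app_df F (ereal x)) x} \<union>
      {x. \<not> isCont (\<lambda>x. app_df L (ereal x)) x})"
    by (intro countable_Un mono_ctble_discont mono_app_df_ereal)
  fix x assume "x \<notin> {x. \<not> isCont (\<lambda>x. app_df F (ereal x)) x} \<union>
      {x. \<not> isCont (\<lambda>x. app_df L (ereal x)) x}"
  then show "app_df F (ereal x) \<le> app_df L (ereal x)"
    using assms by (intro LIMSEQ_le[of "\<lambda>n. app_df (Fs n) (ereal x)" _ "\<lambda>n. app_df (Ls n) (ereal x)"])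
      (auto simp: weak_conv_iff_real less_eq_df_def)
qed

lemma weak_conv_const: "weak_conv (\<lambda>n. F) F"
  by (simp add: weak_conv_def)

text \<open>No limit of \<open>G\<close> at infinity is prescribed: mass escaping to infinity is
  absorbed by a jump to the fixed value 1 there. Hence Helly limits remain distribution
  functions.\<close>

lemma df_of_real_function:
  fixes G :: "real \<Rightarrow> real"
  assumes "mono G" and lc: "\<And>x. continuous (at_left x) G"
    and "\<And>x. 0 \<le> G x" "\<And>x. G x \<le> 1" and "\<And>x. x \<le> 0 \<Longrightarrow> G x = 0"
  obtains F where "\<And>x. app_df F (ereal x) = G x"
proof -
  define H where "H t = (if t = \<infinity> then 1 else if t = -\<infinity> then 0 else G (real_of_ereal t))" for t
  have "mono H"
    unfolding mono_def
  proof (intro allI impI)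
    fix s t :: ereal assume "s \<le> t"
    then show "H s \<le> H t"
      using assms by (cases s; cases t) (auto simp: H_def mono_def)
  qed
  moreover have "(H \<longlongrightarrow> H (ereal x)) (at_left (ereal x))" for x
    using lc[of x] by (simp add: at_left_ereal filterlim_filtermap H_def continuous_within)
  moreover have "0 \<le> H t \<and> H t \<le> 1" for t
    using assms by (simp add: H_def)
  moreover have "H (-\<infinity>) = 0" "H \<infinity> = 1" "H 0 = 0"
    using assms by (simp_all add: H_def)
  ultimately have "app_df (Abs_df H) = H"
    by (intro Abs_df_inverse) simp
  then show thesis
    by (intro that[of "Abs_df H"]) (simp add: H_def)
qed

section \<open>Weak convergence, the modified Levy distance and compactness\<close>

(* Helly's theorem is stated for right-continuous functions; x \<mapsto> - F (- x) exchanges the sides. *)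
lemma df_seq_compact:
  fixes Fs :: "nat \<Rightarrow> df"
  obtains r F where "strict_mono (r :: nat \<Rightarrow> nat)" "weak_conv (Fs \<circ> r) F"
proof -
  define f where "f n x = - app_df (Fs n) (ereal (- x))" for n x
  have "continuous (at_right x) (f n)" for n x
    using app_df_left_cont_real[of "Fs n" "- x"]
    unfolding f_def by (auto simp: continuous_within at_left_minus filterlim_filtermap intro!: tendsto_intros)
  moreover have "mono (f n)" for n
    by (auto simp: mono_def f_def intro!: app_df_mono)
  moreover have "\<bar>f n x\<bar> \<le> 1" for n x
    by (simp add: f_def app_df_ge_0 app_df_le_1)
  ultimately obtain r H where r: "strict_mono r" and H: "\<And>x. continuous (at_right x) H" "mono H"
      "\<And>x. isCont H x \<Longrightarrow> (\<lambda>n. f (r n) x) \<longlonglongrightarrow> H x"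
    using Helly_selection[of f 1] by blast
  define G where "G x = - H (- x)" for x
  have G_mono: "mono G"
    using H(2) by (auto simp: G_def mono_def)
  have G_lc: "continuous (at_left x) G" for x
  proof -
    have "(H \<longlongrightarrow> H (- x)) (at_right (- x))"
      using H(1)[of "- x"] by (simp add: continuous_within)
    then have "((\<lambda>y. H (- y)) \<longlongrightarrow> H (- x)) (at_left x)"
      by (simp add: at_right_minus filterlim_filtermap)
    then show ?thesis
      unfolding G_def continuous_within by (intro tendsto_intros)
  qed
  have G_lim: "(\<lambda>n. app_df (Fs (r n)) (ereal x)) \<longlonglongrightarrow> G x" if "isCont G x" for x
  proof -
    have "isCont (\<lambda>y. - G (- y)) (- x)"
      using that by (intro continuous_intros isCont_o2[where f = uminus and g = G]) simp_all
    then have "(\<lambda>n. f (r n) (- x)) \<longlonglongrightarrow> H (- x)"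
      by (intro H(3)) (simp add: G_def)
    then show ?thesis
      using tendsto_minus by (fastforce simp: f_def G_def)
  qed
  \<comment> \<open>Convergence is known only at continuity points of \<open>G\<close>; monotonicity
    carries the bounds over from such a point to the left or to the right of
    \<open>x\<close>.\<close>
  have bounds: "0 \<le> G x" "G x \<le> 1" for x
  proof -
    obtain y where y: "x - 1 < y" "y < x" "isCont G y" using mono_cont_point[OF G_mono, of "x - 1" x] by auto
    then have "0 \<le> G y"
      by (intro LIMSEQ_le_const[OF G_lim]) (auto simp: app_df_ge_0)
    with y show "0 \<le> G x" using G_mono by (auto simp: mono_def intro: order_trans less_imp_le)
    obtain z where z: "x < z" "isCont G z" using mono_cont_point[OF G_mono, of x "x + 1"] by auto
    then have "G z \<le> 1"
      by (intro LIMSEQ_le_const2[OF G_lim]) (auto simp: app_df_le_1)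
    with z show "G x \<le> 1" using monoD[OF G_mono, of x z] by simp
  qed
  have neg: "G x = 0" if "x < 0" for x
  proof -
    obtain y where y: "x < y" "y < 0" "isCont G y" using mono_cont_point[OF G_mono \<open>x < 0\<close>] by auto
    then have "(\<lambda>n. 0) \<longlonglongrightarrow> G y"
      using G_lim[of y] by (simp add: app_df_nonpos)
    then have "G y = 0" by (simp add: LIMSEQ_const_iff)
    with y bounds[of x] show ?thesis using monoD[OF G_mono, of x y] by simp
  qed
  \<comment> \<open>The point 0 has no continuity point between it and the negative axis to borrow
    from, so its value comes from left-continuity.\<close>
  have "(G \<longlongrightarrow> 0) (at_left 0)"
    by (rule tendsto_eventually) (auto simp: eventually_at_filter neg)
  then have "G 0 = 0"
    using G_lc[of 0] tendsto_unique[of "at_left (0::real)" G] by (simp add: continuous_within)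
  then have "G x = 0" if "x \<le> 0" for x
    using neg[of x] that by (cases "x = 0") auto
  then obtain F where "\<And>x. app_df F (ereal x) = G x"
    using df_of_real_function[OF G_mono G_lc bounds] by blast
  with r G_lim show thesis
    by (intro that[of r F]) (simp_all add: weak_conv_iff_real)
qed

section \<open>The modified Levy distance metrizes weak convergence\<close>

lemma levy_tendsto_imp_weak_conv:
  assumes "(\<lambda>n. levy_dist (Fs n) F) \<longlonglongrightarrow> 0"
  shows "weak_conv Fs F"
  unfolding weak_conv_iff_real
proof (intro allI impI)
  fix x assume cont: "isCont (\<lambda>x. app_df F (ereal x)) x"
  show "(\<lambda>n. app_df (Fs n) (ereal x)) \<longlonglongrightarrow> app_df F (ereal x)"
  proof (cases "x \<le> 0")
    case False
    show ?thesis
    proof (rule LIMSEQ_I)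
      fix e :: real assume "0 < e"
      then have "eventually (\<lambda>y. \<bar>app_df F (ereal y) - app_df F (ereal x)\<bar> < e / 2) (nhds x)"
        using cont unfolding isCont_def tendsto_iff dist_real_def
        by (auto simp: eventually_at_filter elim!: eventually_mono allE[of _ "e / 2"])
      then obtain d where d: "0 < d"
          "\<And>y. \<bar>y - x\<bar> < d \<Longrightarrow> \<bar>app_df F (ereal y) - app_df F (ereal x)\<bar> < e / 2"
        by (auto simp: eventually_nhds_metric dist_real_def)
      \<comment> \<open>The Levy condition at level \<open>h\<close> squeezes \<open>Fs n\<close> at
        \<open>x\<close> between \<open>F(x - h) - h\<close> and \<open>F(x + h) + h\<close>. The
        first two bounds control the error, the last two put \<open>x - h\<close> and
        \<open>x\<close> into the admissible range between 0 and \<open>inverse h\<close>.\<close>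
      define h where "h = min (min (d / 2) (e / 2)) (min (x / 2) (1 / (2 * x)))"
      have h: "0 < h" "h < d" "h \<le> e / 2" "h < x" "h * x \<le> 1 / 2"
      proof -
        have "h \<le> 1 / (2 * x)" by (simp add: h_def)
        then show "h * x \<le> 1 / 2" using False by (simp add: field_simps)
      qed (use False d \<open>0 < e\<close> in \<open>auto simp: h_def\<close>)
      have inv: "x < inverse h"
        using h by (simp add: field_simps)
      have "eventually (\<lambda>n. levy_dist (Fs n) F < h) sequentially"
        using order_tendstoD(2)[OF assms h(1)] .
      then obtain N where N: "\<And>n. N \<le> n \<Longrightarrow> levy_dist (Fs n) F < h"
        by (auto simp: eventually_sequentially)
      show "\<exists>N. \<forall>n\<ge>N. norm (app_df (Fs n) (ereal x) - app_df F (ereal x)) < e"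
      proof (intro exI allI impI)
        fix n assume "N \<le> n"
        from levy_dist_less[OF N[OF this]]
        have c: "levy_cond (Fs n) F h" "levy_cond F (Fs n) h" by auto
        have "app_df (Fs n) (ereal x) \<le> app_df F (ereal (x + h)) + h"
          using c(2) inv h unfolding levy_cond_def by auto
        moreover have "app_df F (ereal (x - h)) \<le> app_df (Fs n) (ereal (x - h + h)) + h"
          using c(1)[unfolded levy_cond_def, rule_format, of "x - h"] inv h by simp
        moreover have "\<bar>app_df F (ereal (x + h)) - app_df F (ereal x)\<bar> < e / 2"
          "\<bar>app_df F (ereal (x - h)) - app_df F (ereal x)\<bar> < e / 2"
          using h d(2)[of "x + h"] d(2)[of "x - h"] by simp_all
        ultimately show "norm (app_df (Fs n) (ereal x) - app_df F (ereal x)) < e"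
          using h(3) unfolding real_norm_def abs_less_iff diff_add_cancel by linarith
      qed
    qed
  qed (simp add: app_df_nonpos)
qed

(* Only finitely many continuity points c i, one in each interval of length h / 2, are needed
   to control the Levy condition at level h. *)
lemma weak_conv_imp_levy_tendsto:
  assumes "weak_conv Fs F"
  shows "(\<lambda>n. levy_dist (Fs n) F) \<longlonglongrightarrow> 0"
proof (rule LIMSEQ_I)
  fix e :: real assume "0 < e"
  define h where "h = e / 2"
  have h: "0 < h" "h < e" using \<open>0 < e\<close> by (auto simp: h_def)
  have "\<exists>y. real i * (h / 2) < y \<and> y < real (Suc i) * (h / 2) \<and> isCont (\<lambda>x. app_df F (ereal x)) y" for i
    using h by (intro mono_cont_point mono_app_df_ereal) simp
  then obtain c where c: "\<And>i. real i * (h / 2) < c i" "\<And>i. c i < real (Suc i) * (h / 2)"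
      "\<And>i. isCont (\<lambda>x. app_df F (ereal x)) (c i)"
    by metis
  \<comment> \<open>The cells up to index \<open>N\<close> cover the range below
    \<open>inverse h\<close> with one further cell, since the point chosen for \<open>t\<close> lies
    in the cell after that of \<open>t\<close>.\<close>
  define N where "N = nat \<lceil>inverse h / (h / 2)\<rceil> + 1"
  have "eventually (\<lambda>n. \<forall>i\<in>{..N}. \<bar>app_df (Fs n) (ereal (c i)) - app_df F (ereal (c i))\<bar> < h) sequentially"
  proof (rule eventually_ball_finite)
    show "\<forall>i\<in>{..N}. eventually (\<lambda>n. \<bar>app_df (Fs n) (ereal (c i)) - app_df F (ereal (c i))\<bar> < h) sequentially"
      using assms c(3) h(1) by (auto simp: weak_conv_iff_real tendsto_iff dist_real_def)
  qed simp
  then obtain m where m: "\<And>n i. m \<le> n \<Longrightarrow> i \<le> N \<Longrightarrow>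
      \<bar>app_df (Fs n) (ereal (c i)) - app_df F (ereal (c i))\<bar> < h"
    by (auto simp: eventually_sequentially)
  have *: "app_df A (ereal t) \<le> app_df B (ereal (t + h)) + h"
    if AB: "\<And>i. i \<le> N \<Longrightarrow> \<bar>app_df A (ereal (c i)) - app_df B (ereal (c i))\<bar> < h"
      and t: "0 < t" "t < inverse h" for A B t
  proof -
    \<comment> \<open>In the cell of \<open>t\<close> itself the chosen point could lie to the left
      of \<open>t\<close>. The next cell lies between \<open>t\<close> and \<open>t + h\<close>,
      because two cells have total length \<open>h\<close>.\<close>
    define i where "i = Suc (nat \<lfloor>t / (h / 2)\<rfloor>)"
    have i: "t / (h / 2) < real i" "real i \<le> t / (h / 2) + 1"
      using t h unfolding i_def by (auto simp: of_nat_nat zero_le_divide_iff) linarith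
    have "t / (h / 2) \<le> inverse h / (h / 2)"
      using t h by (intro divide_right_mono) auto
    then have "\<lfloor>t / (h / 2)\<rfloor> \<le> \<lceil>inverse h / (h / 2)\<rceil>"
      by linarith
    then have "i \<le> N"
      unfolding i_def N_def by (simp add: nat_mono)
    have "t < real i * (h / 2)" "real i * (h / 2) \<le> t + h / 2"
      using i h by (simp_all add: field_simps)
    with c(1)[of i] c(2)[of i] have "t \<le> c i" "c i \<le> t + h"
      by (auto simp: algebra_simps)
    then have "app_df A (ereal t) \<le> app_df A (ereal (c i))"
      "app_df B (ereal (c i)) \<le> app_df B (ereal (t + h))"
      by (auto intro: app_df_mono)
    with AB[OF \<open>i \<le> N\<close>] show ?thesis by linarith
  qed
  show "\<exists>m. \<forall>n\<ge>m. norm (levy_dist (Fs n) F - 0) < e"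
  proof (intro exI allI impI)
    fix n assume n: "m \<le> n"
    have "levy_cond F (Fs n) h"
      unfolding levy_cond_def using *[of "Fs n" F] m[OF n] by (simp add: app_df_ge_0)
    moreover have "levy_cond (Fs n) F h"
      unfolding levy_cond_def using *[of F "Fs n"] m[OF n]
      by (simp add: app_df_ge_0 abs_minus_commute)
    ultimately have "levy_dist (Fs n) F \<le> h"
      using h by (intro levy_dist_le) auto
    then show "norm (levy_dist (Fs n) F - 0) < e"
      using h levy_dist_bounds(1)[of "Fs n" F] by simp
  qed
qed

interpretation levy: Metric_space UNIV levy_dist
  by (rule Metric_space_levy_dist)

lemma limitin_levy_iff: "limitin levy.mtopology Fs F sequentially \<longleftrightarrow> (\<lambda>n. levy_dist (Fs n) F) \<longlonglongrightarrow> 0"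
  by (simp add: levy.limitin_metric_dist_null)

lemma compact_space_levy: "compact_space levy.mtopology"
  unfolding levy.compact_space_sequentially
proof (intro allI impI)
  fix Fs :: "nat \<Rightarrow> df"
  obtain r F where "strict_mono r" "weak_conv (Fs \<circ> r) F"
    by (rule df_seq_compact)
  then show "\<exists>F r. F \<in> UNIV \<and> strict_mono r \<and> limitin levy.mtopology (Fs \<circ> r) F sequentially"
    using weak_conv_imp_levy_tendsto unfolding limitin_levy_iff by blast
qed

section \<open>Neighbourhoods of \<open>H0\<close>\<close>

lemma app_df_H0: "app_df H0 t = (if t \<le> 0 then 0 else 1)"
  by transfer simp

lemma isCont_H0: "0 < x \<Longrightarrow> isCont (\<lambda>x. app_df H0 (ereal x)) x"
  unfolding isCont_def
  by (rule tendsto_eventually) (auto simp: app_df_H0 eventually_at_filter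
      intro: eventually_mono[OF eventually_nhds_in_open[of "{0<..}"]])

text \<open>\<open>H0\<close> is continuous at every positive real, and at nonpositive reals all
  distribution functions vanish.\<close>

lemma weak_conv_H0_iff:
  "weak_conv Fs H0 \<longleftrightarrow> (\<forall>x>0. (\<lambda>n. app_df (Fs n) (ereal x)) \<longlonglongrightarrow> 1)"
proof
  assume "weak_conv Fs H0"
  then show "\<forall>x>0. (\<lambda>n. app_df (Fs n) (ereal x)) \<longlonglongrightarrow> 1"
    using isCont_H0 by (fastforce simp: weak_conv_iff_real app_df_H0)
next
  assume *: "\<forall>x>0. (\<lambda>n. app_df (Fs n) (ereal x)) \<longlonglongrightarrow> 1"
  show "weak_conv Fs H0"
    unfolding weak_conv_iff_real
  proof (intro allI impI)
    fix x show "(\<lambda>n. app_df (Fs n) (ereal x)) \<longlonglongrightarrow> app_df H0 (ereal x)"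
      using * by (cases "x \<le> 0") (auto simp: app_df_H0 app_df_nonpos)
  qed
qed

text \<open>Turns a Levy ball around \<open>H0\<close> into a neighbourhood \<open>pm_nbhd\<close>
  of the same radius.\<close>

lemma levy_dist_H0_less:
  assumes "levy_dist H0 P < t"
  shows "1 - t < app_df P (ereal t)"
proof -
  obtain h where h: "levy_dist H0 P < h" "h < t"
    using dense[OF assms] by blast
  then have "0 < h"
    using levy_dist_bounds(1)[of H0 P] by linarith
  \<comment> \<open>The gap between \<open>h\<close> and \<open>t\<close> leaves room for a positive
    \<open>s\<close>, where \<open>H0\<close> is already 1; the second bound keeps \<open>s\<close>
    in the range of the Levy condition.\<close>
  define s where "s = min (t - h) (inverse h / 2)"
  have s: "0 < s" "s < inverse h" "s + h \<le> t"
    using h \<open>0 < h\<close> by (auto simp: s_def min_def field_simps)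
  have "app_df H0 (ereal s) \<le> app_df P (ereal (s + h)) + h"
    using levy_dist_less[OF h(1)] s by (simp add: levy_cond_def)
  moreover have "app_df P (ereal (s + h)) \<le> app_df P (ereal t)"
    using s by (intro app_df_mono) simp
  ultimately show ?thesis
    using s h by (simp add: app_df_H0)
qed

section \<open>Probabilistic 1-Lipschitz maps\<close>

(* By compactness, a failing sequence would have weak limits F \<noteq> L with
   F = H0 \<star> F \<le> L and L = H0 \<star> L \<le> F. *)
lemma (in triangle_function) uniform_translation_bound:
  assumes cont: "continuous_tf star" and "0 < e"
  obtains d where "0 < d"
    "\<And>P F L. 1 - d < app_df P (ereal d) \<Longrightarrow> P \<star> F \<le> L \<Longrightarrow> P \<star> L \<le> F \<Longrightarrow> levy_dist F L < e"
proof (rule ccontr)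
  note small = that
  assume no: "\<not> thesis"
  have "\<exists>P F L. 1 - d < app_df P (ereal d) \<and> P \<star> F \<le> L \<and> P \<star> L \<le> F \<and> e \<le> levy_dist F L"
    if "0 < d" for d
  proof (rule ccontr)
    assume "\<not> ?thesis"
    with small[OF \<open>0 < d\<close>] no show False by (meson not_le)
  qed
  then have "\<exists>P F L. 1 - inverse (real (Suc n)) < app_df P (ereal (inverse (real (Suc n)))) \<and>
      P \<star> F \<le> L \<and> P \<star> L \<le> F \<and> e \<le> levy_dist F L" for n
    by simp
  then obtain P F L where P: "\<And>n. 1 - inverse (real (Suc n)) < app_df (P n) (ereal (inverse (real (Suc n))))"
    and FL: "\<And>n. P n \<star> F n \<le> L n" and LF: "\<And>n. P n \<star> L n \<le> F n"
    and e: "\<And>n. e \<le> levy_dist (F n) (L n)"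
    by metis
  have P_lim: "weak_conv P H0"
    unfolding weak_conv_H0_iff
  proof (intro allI impI)
    fix x :: real assume "0 < x"
    have inv: "(\<lambda>n. inverse (real (Suc n))) \<longlonglongrightarrow> 0"
      by (rule LIMSEQ_inverse_real_of_nat)
    show "(\<lambda>n. app_df (P n) (ereal x)) \<longlonglongrightarrow> 1"
    proof (rule tendsto_sandwich[of "\<lambda>n. 1 - inverse (real (Suc n))" _ _ "\<lambda>n. 1"])
      show "eventually (\<lambda>n. 1 - inverse (real (Suc n)) \<le> app_df (P n) (ereal x)) sequentially"
        using order_tendstoD(2)[OF inv \<open>0 < x\<close>]
      proof eventually_elim
        case (elim n)
        then have "app_df (P n) (ereal (inverse (real (Suc n)))) \<le> app_df (P n) (ereal x)"
          by (intro app_df_mono) simp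
        with P[of n] show ?case by linarith
      qed
      show "(\<lambda>n. 1 - inverse (real (Suc n))) \<longlonglongrightarrow> 1"
        using tendsto_diff[OF tendsto_const inv, of 1] by simp
    qed (simp_all add: app_df_le_1)
  qed
  obtain r F' where r: "strict_mono r" and F': "weak_conv (F \<circ> r) F'"
    by (rule df_seq_compact)
  obtain s L' where s: "strict_mono s" and L': "weak_conv (L \<circ> r \<circ> s) L'"
    by (rule df_seq_compact)
  \<comment> \<open>Along this common subsequence \<open>P\<close>, \<open>F\<close> and
    \<open>L\<close> all converge, so continuity of the triangle function applies to both
    products.\<close>
  define q where "q = r \<circ> s"
  have sub: "weak_conv (G \<circ> u) G'" if "weak_conv G G'" "strict_mono u" for G G' u
    using that LIMSEQ_subseq_LIMSEQ[OF _ that(2)] by (auto simp: weak_conv_def comp_def)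
  have Pq: "weak_conv (\<lambda>n. P (q n)) H0"
    using sub[OF P_lim strict_mono_o[OF r s]] by (simp add: q_def comp_def)
  have Fq: "weak_conv (\<lambda>n. F (q n)) F'"
    using sub[OF F' s] by (simp add: q_def comp_def)
  have Lq: "weak_conv (\<lambda>n. L (q n)) L'"
    using L' by (simp add: q_def comp_def)
  have "weak_conv (\<lambda>n. P (q n) \<star> F (q n)) (H0 \<star> F')" "weak_conv (\<lambda>n. P (q n) \<star> L (q n)) (H0 \<star> L')"
    using cont Pq Fq Lq unfolding continuous_tf_def by blast+
  then have "F' \<le> L'" "L' \<le> F'"
    using weak_conv_le[OF _ Lq FL] weak_conv_le[OF _ Fq LF] by (simp_all add: left_neutral)
  then have "F' = L'" by simp
  \<comment> \<open>Both sequences approach the same limit, although their terms stay at distance at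
    least \<open>e\<close> from each other.\<close>
  have "(\<lambda>n. levy_dist (F (q n)) F' + levy_dist (L (q n)) F') \<longlonglongrightarrow> 0 + 0"
    using Fq Lq \<open>F' = L'\<close> by (intro tendsto_add weak_conv_imp_levy_tendsto) auto
  moreover have "e \<le> levy_dist (F (q n)) F' + levy_dist (L (q n)) F'" for n
    using e[of "q n"] levy_dist_triangle[of "F (q n)" "L (q n)" F'] by (simp add: levy_dist_commute)
  ultimately have "e \<le> 0"
    by (intro LIMSEQ_le_const[of _ 0]) auto
  with \<open>0 < e\<close> show False by simp
qed

section \<open>The Lipschitz space under the uniform distance\<close>

lemma levy_dist_le_sup_dist: "x \<in> K \<Longrightarrow> levy_dist (f x) (g x) \<le> sup_dist K f g"
  unfolding sup_dist_def
  by (auto intro!: cSUP_upper bdd_aboveI2[where M = 1] levy_dist_bounds)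

lemma sup_dist_le: "0 \<le> c \<Longrightarrow> (\<And>x. x \<in> K \<Longrightarrow> levy_dist (f x) (g x) \<le> c) \<Longrightarrow> sup_dist K f g \<le> c"
  unfolding sup_dist_def by (auto intro!: cSUP_least)

context prob_metric_space
begin

text \<open>By symmetry of \<open>D\<close>, the Lipschitz condition for both orders of
  \<open>x\<close> and \<open>y\<close> is the hypothesis of the translation bound with
  \<open>P = D x y\<close>. Since that bound is uniform in \<open>F\<close> and \<open>L\<close>,
  one \<open>d\<close> serves all maps and all points.\<close>

lemma Lip1_equicontinuous:
  assumes "continuous_tf star" "0 < e"
  obtains d where "0 < d"
    "\<And>f x y. f \<in> Lip1_df K D star \<Longrightarrow> x \<in> K \<Longrightarrow> y \<in> K \<Longrightarrow> 1 - d < app_df (D x y) (ereal d)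
      \<Longrightarrow> levy_dist (f x) (f y) < e"
proof -
  obtain d where d: "0 < d"
    "\<And>P F L. 1 - d < app_df P (ereal d) \<Longrightarrow> P \<star> F \<le> L \<Longrightarrow> P \<star> L \<le> F \<Longrightarrow> levy_dist F L < e"
    using uniform_translation_bound[OF assms] by metis
  show thesis
  proof (rule that[OF d(1)])
    fix f x y assume f: "f \<in> Lip1_df K D star" and xy: "x \<in> K" "y \<in> K"
      and D: "1 - d < app_df (D x y) (ereal d)"
    have "D y x \<star> f x \<le> f y" "D x y \<star> f y \<le> f x"
      using f xy by (auto simp: Lip1_df_def)
    then show "levy_dist (f x) (f y) < e"
      using d(2)[OF D] D_commute[OF xy] by simp
  qed
qed

lemma Lip1_subset_cont:
  assumes "continuous_tf star"
  shows "Lip1_df K D star \<subseteq> cont_df K D"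
proof
  fix f assume f: "f \<in> Lip1_df K D star"
  have "weak_conv (\<lambda>n. f (zs n)) (f z)"
    if z: "z \<in> K" "range zs \<subseteq> K" "weak_conv (\<lambda>n. D (zs n) z) H0" for z zs
  proof (rule levy_tendsto_imp_weak_conv, rule order_tendstoI)
    fix a :: real assume "0 < a"
    then obtain d where d: "0 < d" "\<And>x y. x \<in> K \<Longrightarrow> y \<in> K \<Longrightarrow> 1 - d < app_df (D x y) (ereal d)
      \<Longrightarrow> levy_dist (f x) (f y) < a"
      using Lip1_equicontinuous[OF assms] f by metis
    have "eventually (\<lambda>n. 1 - d < app_df (D (zs n) z) (ereal d)) sequentially"
      using z(3) d(1) order_tendstoD(1)[of _ 1 sequentially "1 - d"] by (simp add: weak_conv_H0_iff)
    then show "eventually (\<lambda>n. levy_dist (f (zs n)) (f z) < a) sequentially"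
      by eventually_elim (use z d(2) in auto)
  next
    fix a :: real assume "a < 0"
    then show "eventually (\<lambda>n. a < levy_dist (f (zs n)) (f z)) sequentially"
      by (intro always_eventually allI) (rule less_le_trans[OF _ levy_dist_bounds(1)])
  qed
  with f show "f \<in> cont_df K D"
    by (simp add: Lip1_df_def cont_df_def)
qed

text \<open>With \<open>D x y\<close> held constant, continuity of the triangle function passes to
  the limit on the left of the Lipschitz inequality, and the order is closed under weak
  limits.\<close>

lemma Lip1_weak_limit:
  assumes "continuous_tf star" "\<And>n. fs n \<in> Lip1_df K D star" "f \<in> extensional K"
    and "\<And>x. x \<in> K \<Longrightarrow> weak_conv (\<lambda>n. fs n x) (f x)"
  shows "f \<in> Lip1_df K D star"
proof -
  have "D x y \<star> f y \<le> f x" if "x \<in> K" "y \<in> K" for x y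
  proof (rule weak_conv_le)
    show "weak_conv (\<lambda>n. D x y \<star> fs n y) (D x y \<star> f y)"
      using assms that weak_conv_const unfolding continuous_tf_def by blast
    show "D x y \<star> fs n y \<le> fs n x" for n
      using assms(2)[of n] that by (simp add: Lip1_df_def)
  qed (use assms that in auto)
  with assms(3) show ?thesis by (simp add: Lip1_df_def)
qed

text \<open>The Lipschitz inequality here is the triangle inequality of \<open>D\<close>. These maps
  carry \<open>K\<close> into the Lipschitz space.\<close>

lemma dist_fun_Lip1:
  assumes "x \<in> K"
  shows "restrict (\<lambda>y. D y x) K \<in> Lip1_df K D star"
  using assms D_triangle by (simp add: Lip1_df_def)

sublocale Lip1: Metric_space "Lip1_df K D star" "sup_dist K"
  by (rule Metric_space_sup_dist) (auto simp: Lip1_df_def)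

text \<open>Pointwise limits exist because the compact space of distribution functions is complete;
  they are again Lipschitz, and the uniform Cauchy property makes the convergence uniform.\<close>

lemma Lip1_mcomplete:
  assumes "continuous_tf star"
  shows "Lip1.mcomplete"
  unfolding Lip1.mcomplete_def
proof (intro allI impI)
  fix fs assume fs: "Lip1.MCauchy fs"
  have Lip: "fs n \<in> Lip1_df K D star" for n
    using fs by (auto simp: Lip1.MCauchy_def)
  have "\<exists>F. (\<lambda>n. levy_dist (fs n x) F) \<longlonglongrightarrow> 0" if "x \<in> K" for x
  proof -
    have "levy.MCauchy (\<lambda>n. fs n x)"
      using fs levy_dist_le_sup_dist[OF that] unfolding Lip1.MCauchy_def levy.MCauchy_def
      by (meson subset_UNIV le_less_trans)
    then show ?thesis
      using compact_space_levy levy.compact_space_eq_mcomplete_mtotally_bounded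
      by (auto simp: levy.mcomplete_def limitin_levy_iff)
  qed
  then obtain g where g: "\<And>x. x \<in> K \<Longrightarrow> (\<lambda>n. levy_dist (fs n x) (g x)) \<longlonglongrightarrow> 0"
    by metis
  let ?g = "restrict g K"
  have "?g \<in> Lip1_df K D star"
    using assms Lip by (rule Lip1_weak_limit) (auto intro: levy_tendsto_imp_weak_conv g)
  moreover have "\<exists>N. \<forall>n\<ge>N. sup_dist K (fs n) ?g < e" if "0 < e" for e
  proof -
    have "0 < e / 2" using that by simp
    then obtain N where N: "\<And>n m. N \<le> n \<Longrightarrow> N \<le> m \<Longrightarrow> sup_dist K (fs n) (fs m) < e / 2"
      using fs unfolding Lip1.MCauchy_def by blast
    have "sup_dist K (fs n) ?g \<le> e / 2" if n: "N \<le> n" for n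
    proof (rule sup_dist_le)
      fix x assume x: "x \<in> K"
      \<comment> \<open>Letting \<open>m\<close> tend to infinity with \<open>n\<close> fixed
        removes the last term, with \<open>N\<close> independent of \<open>x\<close>.\<close>
      have "levy_dist (fs n x) (g x) \<le> e / 2 + levy_dist (fs m x) (g x)" if "N \<le> m" for m
        using levy_dist_triangle[of "fs n x" "g x" "fs m x"] N[OF n that]
          levy_dist_le_sup_dist[OF x, of "fs n" "fs m"] by linarith
      moreover have "(\<lambda>m. e / 2 + levy_dist (fs m x) (g x)) \<longlonglongrightarrow> e / 2 + 0"
        by (intro tendsto_intros g x)
      ultimately show "levy_dist (fs n x) (?g x) \<le> e / 2"
        using x by (intro LIMSEQ_le_const[where X = "\<lambda>m. e / 2 + levy_dist (fs m x) (g x)"]) auto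
    qed (use \<open>0 < e\<close> in simp)
    then show ?thesis
      using \<open>0 < e\<close> by (intro exI[of _ N]) force
  qed
  ultimately have "limitin Lip1.mtopology fs ?g sequentially"
    using Lip by (simp add: Lip1.limit_metric_sequentially)
  then show "\<exists>f. limitin Lip1.mtopology fs f sequentially" by (rule exI[of _ ?g])
qed

(* Up to e, a Lipschitz map is determined by the approximations, from a finite net A of df,
   of its values on a finite net X of K. *)
lemma Lip1_mtotally_bounded:
  assumes cont: "continuous_tf star" and K: "pm_compact K D"
  shows "Lip1.mtotally_bounded (Lip1_df K D star)"
  unfolding Lip1.mtotally_bounded_def
proof (intro allI impI)
  fix e :: real assume "0 < e"
  \<comment> \<open>Four errors of size \<open>e / 5\<close> occur below; the spare fifth keeps the
    supremum strictly below \<open>e\<close>.\<close>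
  then have e5: "0 < e / 5" by simp
  let ?S = "Lip1_df K D star"
  obtain d where d: "0 < d"
    "\<And>f x y. f \<in> ?S \<Longrightarrow> x \<in> K \<Longrightarrow> y \<in> K \<Longrightarrow> 1 - d < app_df (D x y) (ereal d)
      \<Longrightarrow> levy_dist (f x) (f y) < e / 5"
    using Lip1_equicontinuous[OF cont e5] by metis
  obtain X where X: "finite X" "X \<subseteq> K" "K \<subseteq> (\<Union>x\<in>X. pm_nbhd K D x d)"
    using K d(1) unfolding pm_compact_def by blast
  have "levy.mtotally_bounded UNIV"
    using compact_space_levy levy.compact_space_eq_mcomplete_mtotally_bounded by blast
  then obtain A where A: "finite A" "UNIV \<subseteq> (\<Union>a\<in>A. levy.mball a (e / 5))"
    using e5 unfolding levy.mtotally_bounded_def by blast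
  have "\<exists>a\<in>A. levy_dist a F < e / 5" for F
    using subsetD[OF A(2) UNIV_I, of F] by auto
  then obtain pick where pick: "\<And>F. pick F \<in> A" "\<And>F. levy_dist (pick F) F < e / 5"
    by metis
  define code where "code f = restrict (\<lambda>x. pick (f x)) X" for f :: "'a \<Rightarrow> df"
  have fin: "finite (code ` ?S)"
    by (rule finite_subset[of _ "X \<rightarrow>\<^sub>E A"]) (auto simp: code_def pick(1) X(1) A(1) intro!: finite_PiE)
  have close: "sup_dist K f g < e" if f: "f \<in> ?S" and g: "g \<in> ?S" and fg: "code f = code g" for f g
  proof -
    have "levy_dist (f y) (g y) \<le> 4 * (e / 5)" if y: "y \<in> K" for y
    proof -
      obtain x where x: "x \<in> X" "1 - d < app_df (D x y) (ereal d)"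
        using X(3) y by (auto simp: pm_nbhd_def)
      then have xK: "x \<in> K" using X(2) by blast
      have "pick (f x) = pick (g x)"
        using fun_cong[OF fg, of x] x(1) by (simp add: code_def)
      \<comment> \<open>The path runs from \<open>f y\<close> to \<open>f x\<close>, to the common
        approximation \<open>pick (f x) = pick (g x)\<close>, to \<open>g x\<close> and to
        \<open>g y\<close>.\<close>
      then show ?thesis
        using d(2)[OF f xK y x(2)] d(2)[OF g xK y x(2)] pick(2)[of "f x"] pick(2)[of "g x"]
          levy_dist_triangle[of "f y" "g y" "f x"] levy_dist_triangle[of "f x" "g y" "pick (f x)"]
          levy_dist_triangle[of "pick (g x)" "g y" "g x"]
          levy_dist_commute[of "f y" "f x"] levy_dist_commute[of "f x" "pick (f x)"]
        by simp
    qed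
    then have "sup_dist K f g \<le> 4 * (e / 5)"
      using \<open>0 < e\<close> by (intro sup_dist_le) auto
    then show ?thesis using \<open>0 < e\<close> by simp
  qed
  show "\<exists>C. finite C \<and> C \<subseteq> ?S \<and> ?S \<subseteq> (\<Union>f\<in>C. Lip1.mball f e)"
  proof (intro exI conjI)
    \<comment> \<open>One Lipschitz map is selected for each code that occurs, so the centres of the
      net lie in the Lipschitz space.\<close>
    show "finite (inv_into ?S code ` code ` ?S)" using fin by simp
    show "inv_into ?S code ` code ` ?S \<subseteq> ?S" by (auto intro: inv_into_into)
    show "?S \<subseteq> (\<Union>f\<in>inv_into ?S code ` code ` ?S. Lip1.mball f e)"
    proof
      fix f assume f: "f \<in> ?S"
      then have "code f \<in> code ` ?S" by blast
      then have "inv_into ?S code (code f) \<in> ?S" "code (inv_into ?S code (code f)) = code f"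
        by (rule inv_into_into, rule f_inv_into_f)
      with f show "f \<in> (\<Union>f\<in>inv_into ?S code ` code ` ?S. Lip1.mball f e)"
        using close by (auto simp: Lip1.in_mball)
    qed
  qed
qed

lemma pm_compact_if_Lip1_mtotally_bounded:
  assumes "pm_complete K D" and tb: "Lip1.mtotally_bounded (Lip1_df K D star)"
  shows "pm_compact K D"
  unfolding pm_compact_def
proof (intro conjI allI impI assms(1))
  fix t :: real assume "0 < t"
  let ?e = "\<lambda>x. restrict (\<lambda>y. D y x) K"
  \<comment> \<open>Restricting to the image of \<open>K\<close> makes the centres of the net
    distance functions of points of \<open>K\<close>; these points form the net of
    \<open>K\<close>.\<close>
  have tb_e: "Lip1.mtotally_bounded (?e ` K)"
    by (rule Lip1.mtotally_bounded_subset[OF tb]) (rule image_subsetI[OF dist_fun_Lip1])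
  obtain C where C: "finite C" "C \<subseteq> ?e ` K" "?e ` K \<subseteq> (\<Union>f\<in>C. Lip1.mball f t)"
    using tb_e[unfolded Lip1.mtotally_bounded_def, rule_format, OF \<open>0 < t\<close>] by (elim exE conjE)
  obtain X where X: "X \<subseteq> K" "finite X" "C = ?e ` X"
    using finite_subset_image[OF C(1,2)] by blast
  have "K \<subseteq> (\<Union>x\<in>X. pm_nbhd K D x t)"
  proof
    fix y assume y: "y \<in> K"
    then obtain x where x: "x \<in> X" "sup_dist K (?e x) (?e y) < t"
      using C(3) X(3) by (auto simp: Lip1.in_mball)
    then have xK: "x \<in> K" using X(1) by blast
    \<comment> \<open>Evaluation at \<open>y\<close> is the right choice because
      \<open>D y y\<close> is \<open>H0\<close>.\<close>
    have "levy_dist (D y x) (D y y) < t"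
      using levy_dist_le_sup_dist[OF y, of "?e x" "?e y"] x(2) y by simp
    then have "levy_dist H0 (D x y) < t"
      using D_eq_H0_iff[of y y] D_commute[OF y xK] y by (simp add: levy_dist_commute)
    then show "y \<in> (\<Union>x\<in>X. pm_nbhd K D x t)"
      using x(1) y levy_dist_H0_less by (auto simp: pm_nbhd_def)
  qed
  with X show "\<exists>X. finite X \<and> X \<subseteq> K \<and> K \<subseteq> (\<Union>x\<in>X. pm_nbhd K D x t)" by blast
qed

end

theorem theorem1:
  fixes K :: "'a set" and D :: "'a \<Rightarrow> 'a \<Rightarrow> df" and star :: "df \<Rightarrow> df \<Rightarrow> df"
  assumes "prob_metric_space K D star"
    and "pm_complete K D"
    and "continuous_tf star"
    and "sup_continuous_tf star"
  shows "(pm_compact K D \<longleftrightarrow>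
            compact_space (Metric_space.mtopology (Lip1_df K D star) (sup_dist K))) \<and>
         (compact_space (Metric_space.mtopology (Lip1_df K D star) (sup_dist K)) \<longleftrightarrow>
            compactin (Metric_space.mtopology (cont_df K D) (sup_dist K)) (Lip1_df K D star))"
proof -
  interpret prob_metric_space K D star by fact
  interpret cont: Metric_space "cont_df K D" "sup_dist K"
    by (rule Metric_space_sup_dist) (auto simp: cont_df_def)
  interpret sub: Submetric "cont_df K D" "sup_dist K" "Lip1_df K D star"
    by unfold_locales (rule Lip1_subset_cont[OF assms(3)])
  \<comment> \<open>A metric space is compact iff it is complete and totally bounded. As the
    Lipschitz space is complete, only total boundedness has to be compared with compactness of
    \<open>K\<close>.\<close>
  have "pm_compact K D \<longleftrightarrow> compact_space Lip1.mtopology"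
    using Lip1.compact_space_eq_mcomplete_mtotally_bounded Lip1_mcomplete[OF assms(3)]
      Lip1_mtotally_bounded[OF assms(3)] pm_compact_if_Lip1_mtotally_bounded[OF assms(2)]
    by blast
  \<comment> \<open>Both spaces carry the same distance, so the topology of the Lipschitz space is
    the subspace topology.\<close>
  moreover have "compact_space Lip1.mtopology \<longleftrightarrow> compactin cont.mtopology (Lip1_df K D star)"
    using sub.subset by (simp add: compactin_subspace sub.mtopology_submetric)
  ultimately show ?thesis by blast
qed

end
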